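(* For every integer $n\geq 4$, the class $\mathcal{K}_n$ is minor-closed: every minor of a matroid in $\mathcal{K}_n$ is in $\mathcal{K}_n$.
   Context: All matroids are finite. For a matroid $M$ with rank function $r$ and ground set $E(M)$, and an integer $n\geq 4$, the $n$-th Kinser inequality for a family $X_1,\dots,X_n$ of subsets of $E(M)$ is $$\sum_{i=3}^n r(X_i)+r(X_1\cup X_2)+r(X_1\cup X_3\cup X_n)+\sum_{i=4}^n r(X_2\cup X_{i-1}\cup X_i)\leq r(X_1\cup X_3)+r(X_1\cup X_n)+\sum_{i=3}^n r(X_2\cup X_i)+\sum_{i=4}^n r(X_{i-1}\cup X_i).$$ $\mathcal{K}_n$ is the class of matroids $M$ that satisfy the $n$-th Kinser inequality for all families $X_1,\dots,X_n$ of subsets of $E(M)$. *)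

theory Defs
  imports Main
begin

record 'a set_system =
  ground :: "'a set"
  indep :: "'a set set"

locale matroid =
  fixes M :: "'a set_system"
  assumes finite_ground: "finite (ground M)"
    and indep_subset_ground: "I \<in> indep M \<Longrightarrow> I \<subseteq> ground M"
    and empty_indep: "{} \<in> indep M"
    and indep_subset: "I \<in> indep M \<Longrightarrow> J \<subseteq> I \<Longrightarrow> J \<in> indep M"
    and augment: "I \<in> indep M \<Longrightarrow> J \<in> indep M \<Longrightarrow> card I < card J \<Longrightarrow>
      \<exists>e\<in>J - I. insert e I \<in> indep M"

definition bases :: "'a set_system \<Rightarrow> 'a set set" where
  "bases M = {B \<in> indep M. \<forall>I\<in>indep M. B \<subseteq> I \<longrightarrow> I = B}"

definition rank :: "'a set_system \<Rightarrow> 'a set \<Rightarrow> nat" where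
  "rank M X = Max (card ` {I \<in> indep M. I \<subseteq> X})"

text \<open>The dual is the matroid whose bases are the complements of the bases of \<open>M\<close>.\<close>

definition dual :: "'a set_system \<Rightarrow> 'a set_system" where
  "dual M = \<lparr>ground = ground M, indep = {I. \<exists>B\<in>bases M. I \<subseteq> ground M - B}\<rparr>"

definition delete :: "'a set_system \<Rightarrow> 'a set \<Rightarrow> 'a set_system" where
  "delete M D = \<lparr>ground = ground M - D, indep = {I \<in> indep M. I \<inter> D = {}}\<rparr>"

definition contract :: "'a set_system \<Rightarrow> 'a set \<Rightarrow> 'a set_system" where
  "contract M C = dual (delete (dual M) C)"

text \<open>\<open>minor N M\<close> reads ``\<open>N\<close> is a minor of \<open>M\<close>''.\<close>

inductive minor :: "'a set_system \<Rightarrow> 'a set_system \<Rightarrow> bool" where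
  minor_refl: "minor M M"
| minor_delete: "minor N M \<Longrightarrow> D \<subseteq> ground N \<Longrightarrow> minor (delete N D) M"
| minor_contract: "minor N M \<Longrightarrow> C \<subseteq> ground N \<Longrightarrow> minor (contract N C) M"

definition minor_closed :: "'a set_system set \<Rightarrow> bool" where
  "minor_closed \<C> \<longleftrightarrow> (\<forall>M\<in>\<C>. \<forall>N. minor N M \<longrightarrow> N \<in> \<C>)"

text \<open>The family is \<open>X 1, \<dots>, X n\<close>; values of \<open>X\<close> at other indices do not occur.\<close>

definition kinser_inequality :: "nat \<Rightarrow> 'a set_system \<Rightarrow> (nat \<Rightarrow> 'a set) \<Rightarrow> bool" where
  "kinser_inequality n M X \<longleftrightarrow>
     (\<Sum>i=3..n. rank M (X i)) + rank M (X 1 \<union> X 2) + rank M (X 1 \<union> X 3 \<union> X n)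
       + (\<Sum>i=4..n. rank M (X 2 \<union> X (i - 1) \<union> X i))
     \<le> rank M (X 1 \<union> X 3) + rank M (X 1 \<union> X n) + (\<Sum>i=3..n. rank M (X 2 \<union> X i))
       + (\<Sum>i=4..n. rank M (X (i - 1) \<union> X i))"

definition kinser_class :: "nat \<Rightarrow> 'a set_system set" where
  "kinser_class n = {M. matroid M \<and>
     (\<forall>X. (\<forall>i\<in>{1..n}. X i \<subseteq> ground M) \<longrightarrow> kinser_inequality n M X)}"

end

theory Submission
  imports Defs
begin

text \<open>
  Both minor operations change the rank function only by a shift: there are a set \<open>C\<close> and a
  constant \<open>c\<close> with \<open>r\<^sub>N(Y) + c = r\<^sub>M(Y \<union> C)\<close> for all \<open>Y \<subseteq> E(N)\<close>. For a deletion \<open>C = {}\<close> and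
  \<open>c = 0\<close>; for a contraction of \<open>C\<close> the constant is \<open>r\<^sub>M(C)\<close>.

  Substituting \<open>X i \<union> C\<close> for \<open>X i\<close> in the Kinser inequality of \<open>M\<close> adds \<open>C\<close> to the argument of
  every rank term, since each argument is a nonempty union of members of the family. Each side
  has \<open>2n - 3\<close> rank terms, so the constant \<open>c\<close> cancels and the Kinser inequality of \<open>N\<close> for the
  original family remains (\<open>kinser_inequality_shift\<close>).

  As contraction is defined through duality, its rank formula is obtained by applying the corank
  formula \<open>r\<^sup>*(X) + r(E) = |X| + r(E - X)\<close> (\<open>rank_dual\<close>) twice, once to \<open>M\<close> and once to the
  deletion of \<open>C\<close> from the dual of \<open>M\<close>. This in turn requires the dual to be a matroid.
\<close>

section \<open>Rank and bases\<close>

context matroid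
begin

lemma finite_indep: "I \<in> indep M \<Longrightarrow> finite I"
  using finite_ground indep_subset_ground finite_subset by blast

lemma finite_indep_sets: "finite {I \<in> indep M. I \<subseteq> X}"
  using finite_ground indep_subset_ground
  by (auto intro: finite_subset[of _ "Pow (ground M)"])

lemma card_le_rank: "I \<in> indep M \<Longrightarrow> I \<subseteq> X \<Longrightarrow> card I \<le> rank M X"
  unfolding rank_def using finite_indep_sets by (intro Max_ge) auto

lemma rank_attained:
  obtains I where "I \<in> indep M" "I \<subseteq> X" "card I = rank M X"
proof -
  have "rank M X \<in> card ` {I \<in> indep M. I \<subseteq> X}"
    unfolding rank_def using finite_indep_sets empty_indep by (intro Max_in) auto
  then show thesis using that by auto
qed

lemma extend_to_rank:
  assumes "I \<in> indep M" "I \<subseteq> X"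
  obtains B where "B \<in> indep M" "I \<subseteq> B" "B \<subseteq> X" "card B = rank M X"
proof -
  let ?S = "{B \<in> indep M. I \<subseteq> B \<and> B \<subseteq> X}"
  have "finite ?S" by (rule finite_subset[OF _ finite_indep_sets[of X]]) auto
  moreover have "I \<in> ?S" using assms by auto
  ultimately have "Max (card ` ?S) \<in> card ` ?S" by (intro Max_in) auto
  then obtain B where B: "B \<in> ?S" and max: "card B = Max (card ` ?S)" by auto
  obtain J where J: "J \<in> indep M" "J \<subseteq> X" "card J = rank M X" by (rule rank_attained)
  have "\<not> card B < card J"
  proof
    assume "card B < card J"
    then obtain e where e: "e \<in> J - B" "insert e B \<in> indep M"
      using augment B J by blast
    then have "insert e B \<in> ?S" using B J by auto
    then have "card (insert e B) \<le> card B"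
      unfolding max using \<open>finite ?S\<close> by (intro Max_ge) auto
    then show False using e B finite_indep by auto
  qed
  then have "card B = rank M X" using J card_le_rank[of B X] B by auto
  then show thesis using that B by auto
qed

lemma bases_iff: "B \<in> bases M \<longleftrightarrow> B \<in> indep M \<and> card B = rank M (ground M)"
proof
  assume B: "B \<in> bases M"
  then have "B \<in> indep M" by (simp add: bases_def)
  then obtain B' where "B' \<in> indep M" "B \<subseteq> B'" "card B' = rank M (ground M)"
    using extend_to_rank[OF _ indep_subset_ground] by metis
  then show "B \<in> indep M \<and> card B = rank M (ground M)"
    using B by (auto simp: bases_def)
next
  assume B: "B \<in> indep M \<and> card B = rank M (ground M)"
  have "I = B" if I: "I \<in> indep M" "B \<subseteq> I" for I
    using card_seteq[OF finite_indep[OF I(1)] I(2)] B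
      card_le_rank[OF I(1) indep_subset_ground[OF I(1)]] by simp
  then show "B \<in> bases M" using B by (auto simp: bases_def)
qed

lemma extend_to_basis:
  assumes "I \<in> indep M"
  obtains B where "B \<in> bases M" "I \<subseteq> B"
  by (rule extend_to_rank[OF assms indep_subset_ground[OF assms]]) (simp add: bases_iff that)

lemma indep_basis: "B \<in> bases M \<Longrightarrow> B \<in> indep M"
  by (simp add: bases_iff)

lemma basis_subset_ground: "B \<in> bases M \<Longrightarrow> B \<subseteq> ground M"
  by (intro indep_subset_ground indep_basis)

section \<open>The dual matroid\<close>

lemma indep_dual_iff:
  "I \<in> indep (dual M) \<longleftrightarrow> I \<subseteq> ground M \<and> (\<exists>B\<in>bases M. B \<inter> I = {})"
  by (auto simp: dual_def)

text \<open>
  A coindependent set \<open>I\<close> is augmented from a larger coindependent \<open>J\<close> by avoiding it with a basis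
  \<open>B\<close> that imitates a basis \<open>B'\<close> avoiding \<open>J\<close>: any element of \<open>J - I\<close> missed by \<open>B\<close> can be added
  to \<open>I\<close>. Were none missed, \<open>B\<close> would contain both \<open>B' - I\<close> and \<open>J - I\<close>, which is too much for
  its size.
\<close>

lemma matroid_dual: "matroid (dual M)"
proof
  show "finite (ground (dual M))" using finite_ground by (simp add: dual_def)
  show "I \<subseteq> ground (dual M)" if "I \<in> indep (dual M)" for I
    using that by (auto simp: dual_def)
  show "{} \<in> indep (dual M)"
    using extend_to_basis[OF empty_indep] by (auto simp: indep_dual_iff)
  show "J \<in> indep (dual M)" if "I \<in> indep (dual M)" "J \<subseteq> I" for I J
    using that unfolding indep_dual_iff by blast
next
  fix I J assume I: "I \<in> indep (dual M)" and J: "J \<in> indep (dual M)" and less: "card I < card J"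
  have fin: "finite I" "finite J"
    using I J finite_ground finite_subset by (auto simp: indep_dual_iff)
  obtain B0 where B0: "B0 \<in> bases M" "B0 \<inter> I = {}" using I by (auto simp: indep_dual_iff)
  obtain B' where B': "B' \<in> bases M" "B' \<inter> J = {}" using J by (auto simp: indep_dual_iff)
  have "B' - I \<in> indep M" "B' - I \<subseteq> ground M - I"
    using indep_subset[OF indep_basis[OF B'(1)] Diff_subset] basis_subset_ground[OF B'(1)] by auto
  then obtain B where B: "B \<in> indep M" "B' - I \<subseteq> B" "B \<subseteq> ground M - I"
    "card B = rank M (ground M - I)"
    by (rule extend_to_rank)
  \<comment> \<open>The existence of \<open>B0\<close> says that \<open>ground M - I\<close> has full rank, so \<open>B\<close> is a basis.\<close>
  have "B0 \<subseteq> ground M - I" using B0 basis_subset_ground by blast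
  then have "rank M (ground M) \<le> card B"
    using card_le_rank[of B0 "ground M - I"] B0 B by (simp add: bases_iff)
  then have basis: "B \<in> bases M" "card B = card B'"
    using card_le_rank[OF B(1) indep_subset_ground[OF B(1)]] B B' by (auto simp: bases_iff)
  have "\<not> J - I \<subseteq> B"
  proof
    assume "J - I \<subseteq> B"
    have finB: "finite B" "finite B'" using B(1) B'(1) finite_indep indep_basis by auto
    have "card (B' - I) + card (J - I) = card ((B' - I) \<union> (J - I))"
      using fin finB B' by (subst card_Un_disjoint) auto
    also have "\<dots> \<le> card B" using \<open>J - I \<subseteq> B\<close> B finB by (intro card_mono) auto
    finally have 1: "card (B' - I) + card (J - I) \<le> card B" .
    have 2: "card B' = card (B' - I) + card (B' \<inter> I)"
      using finB card_Int_Diff[of B' I] by simp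
    have 3: "card (B' \<inter> I) \<le> card (I - J)" using B' fin by (intro card_mono) auto
    have 4: "card (I - J) + card J = card (J - I) + card I"
      using fin card_Int_Diff[of I J] card_Int_Diff[of J I] by (simp add: Int_commute)
    show False using 1 2 3 4 basis less by linarith
  qed
  then obtain e where "e \<in> J - I" "e \<notin> B" by blast
  then show "\<exists>e\<in>J - I. insert e I \<in> indep (dual M)"
    using I J B basis by (intro bexI[of _ e]) (auto simp: indep_dual_iff)
qed

text \<open>
  The largest coindependent subsets of \<open>X\<close> are the sets \<open>X - B\<close> for bases \<open>B\<close> meeting \<open>X\<close> as
  little as possible, that is, for bases that extend a largest independent subset of the
  complement of \<open>X\<close>.
\<close>

lemma rank_dual:
  assumes X: "X \<subseteq> ground M"
  shows "rank (dual M) X + rank M (ground M) = card X + rank M (ground M - X)"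
proof -
  interpret D: matroid "dual M" by (rule matroid_dual)
  have finX: "finite X" using X finite_ground finite_subset by blast
  have card_diff: "card Y = card (Y - Z) + card (Y \<inter> Z)" if "finite Y" for Y Z :: "'a set"
    using card_Int_Diff[OF that, of Z] by simp
  have card_basis: "rank M (ground M) = card (B - X) + card (X \<inter> B)" if "B \<in> bases M" for B
    using that card_diff[of B X] finite_indep by (auto simp: bases_iff Int_commute)
  obtain I where I: "I \<in> indep (dual M)" "I \<subseteq> X" "card I = rank (dual M) X"
    by (rule D.rank_attained)
  then obtain B where B: "B \<in> bases M" "B \<inter> I = {}" by (auto simp: indep_dual_iff)
  have "B - X \<in> indep M" "B - X \<subseteq> ground M - X"
    using indep_subset[OF indep_basis[OF B(1)] Diff_subset] basis_subset_ground[OF B(1)] by auto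
  then have "card (B - X) \<le> rank M (ground M - X)" by (rule card_le_rank)
  moreover have "card I \<le> card (X - B)" using I B finX by (intro card_mono) auto
  ultimately have upper:
    "rank (dual M) X + rank M (ground M) \<le> card X + rank M (ground M - X)"
    using I card_basis[OF B(1)] card_diff[OF finX, of B] by linarith
  obtain A where A: "A \<in> indep M" "A \<subseteq> ground M - X" "card A = rank M (ground M - X)"
    by (rule rank_attained)
  obtain B where B: "B \<in> bases M" "A \<subseteq> B" using extend_to_basis A by blast
  have "card A \<le> card (B - X)"
    using A B finite_indep by (intro card_mono) (auto simp: bases_iff)
  moreover have "X - B \<in> indep (dual M)" using X B by (auto simp: indep_dual_iff)
  then have "card (X - B) \<le> rank (dual M) X" by (intro D.card_le_rank) auto
  ultimately have "card X + rank M (ground M - X) \<le> rank (dual M) X + rank M (ground M)"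
    using A card_basis[OF B(1)] card_diff[OF finX, of B] by linarith
  with upper show ?thesis by linarith
qed

section \<open>Deletion and contraction\<close>

lemma matroid_delete: "matroid (delete M D)"
proof
  show "finite (ground (delete M D))" using finite_ground by (simp add: delete_def)
  show "I \<subseteq> ground (delete M D)" if "I \<in> indep (delete M D)" for I
    using that indep_subset_ground by (auto simp: delete_def)
  show "{} \<in> indep (delete M D)" using empty_indep by (simp add: delete_def)
  show "J \<in> indep (delete M D)" if "I \<in> indep (delete M D)" "J \<subseteq> I" for I J
    using that indep_subset by (auto simp: delete_def)
  show "\<exists>e\<in>J - I. insert e I \<in> indep (delete M D)"
    if "I \<in> indep (delete M D)" "J \<in> indep (delete M D)" "card I < card J" for I J
    using that augment[of I J] by (fastforce simp: delete_def)
qed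

end

lemma rank_delete: "X \<inter> D = {} \<Longrightarrow> rank (delete M D) X = rank M X"
  unfolding rank_def delete_def by (rule arg_cong[of _ _ "\<lambda>S. Max (card ` S)"]) auto

lemma ground_delete: "ground (delete M D) = ground M - D"
  by (simp add: delete_def)

lemma ground_dual: "ground (dual M) = ground M"
  by (simp add: dual_def)

lemma ground_contract: "ground (contract M C) = ground M - C"
  by (simp add: contract_def ground_delete ground_dual)

lemma (in matroid) matroid_contract: "matroid (contract M C)"
  unfolding contract_def by (intro matroid.matroid_dual matroid.matroid_delete matroid_axioms)

lemma (in matroid) rank_contract:
  assumes C: "C \<subseteq> ground M" and X: "X \<subseteq> ground M - C"
  shows "rank (contract M C) X + rank M C = rank M (X \<union> C)"
proof -
  let ?E = "ground M" and ?N = "delete (dual M) C"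
  interpret N: matroid ?N by (intro matroid.matroid_delete matroid_dual)
  have "rank ?N (?E - C) = rank (dual M) (?E - C)"
    "rank ?N (?E - C - X) = rank (dual M) (?E - C - X)"
    by (auto intro!: rank_delete)
  then have "rank (contract M C) X + rank (dual M) (?E - C)
    = card X + rank (dual M) (?E - C - X)"
    using N.rank_dual[of X] X by (simp add: contract_def ground_delete ground_dual)
  moreover have "rank (dual M) (?E - C) + rank M ?E = card (?E - C) + rank M C"
    using rank_dual[of "?E - C"] C by (simp add: double_diff)
  moreover have "rank (dual M) (?E - C - X) + rank M ?E = card (?E - C - X) + rank M (X \<union> C)"
  proof -
    have "?E - (?E - C - X) = X \<union> C" using C X by auto
    then show ?thesis using rank_dual[of "?E - C - X"] by auto
  qed
  moreover have "card (?E - C) = card X + card (?E - C - X)"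
    using X finite_ground card_Int_Diff[of "?E - C" X] by (simp add: Int_absorb1)
  ultimately show ?thesis by linarith
qed

section \<open>Transfer of the Kinser inequality\<close>

lemma kinser_inequality_shift:
  assumes n: "n \<ge> 4"
    and shift: "\<And>Y. Y \<subseteq> ground N \<Longrightarrow> rank N Y + c = rank M (Y \<union> C)"
    and X: "\<forall>i\<in>{1..n}. X i \<subseteq> ground N"
    and M: "kinser_inequality n M (\<lambda>i. X i \<union> C)"
  shows "kinser_inequality n N X"
proof -
  have Un: "A \<union> C \<union> (B \<union> C) = A \<union> B \<union> C" for A B by auto
  have sub: "X i \<subseteq> ground N" if "1 \<le> i" "i \<le> n" for i using X that by auto
  have r: "rank M (Y \<union> C) = rank N Y + c" if "Y \<subseteq> ground N" for Y using shift[OF that] by simp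
  have "rank M (X 1 \<union> X 2 \<union> C) = rank N (X 1 \<union> X 2) + c"
    "rank M (X 1 \<union> X 3 \<union> X n \<union> C) = rank N (X 1 \<union> X 3 \<union> X n) + c"
    "rank M (X 1 \<union> X 3 \<union> C) = rank N (X 1 \<union> X 3) + c"
    "rank M (X 1 \<union> X n \<union> C) = rank N (X 1 \<union> X n) + c"
    using n by (intro r Un_least sub; simp)+
  moreover have
    "(\<Sum>i=3..n. rank M (X i \<union> C)) = (\<Sum>i=3..n. rank N (X i) + c)"
    "(\<Sum>i=3..n. rank M (X 2 \<union> X i \<union> C)) = (\<Sum>i=3..n. rank N (X 2 \<union> X i) + c)"
    "(\<Sum>i=4..n. rank M (X 2 \<union> X (i - 1) \<union> X i \<union> C))
      = (\<Sum>i=4..n. rank N (X 2 \<union> X (i - 1) \<union> X i) + c)"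
    "(\<Sum>i=4..n. rank M (X (i - 1) \<union> X i \<union> C)) = (\<Sum>i=4..n. rank N (X (i - 1) \<union> X i) + c)"
    using n by (intro sum.cong refl r Un_least sub; auto)+
  ultimately show ?thesis
    using M unfolding kinser_inequality_def Un by (simp only: sum.distrib)
qed

lemma kinser_class_shift:
  assumes "n \<ge> 4" "M \<in> kinser_class n" "matroid N"
    and "ground N \<subseteq> ground M" "C \<subseteq> ground M"
    and shift: "\<And>Y. Y \<subseteq> ground N \<Longrightarrow> rank N Y + c = rank M (Y \<union> C)"
  shows "N \<in> kinser_class n"
proof -
  have "kinser_inequality n N X" if X: "\<forall>i\<in>{1..n}. X i \<subseteq> ground N" for X
  proof -
    have "\<forall>i\<in>{1..n}. X i \<union> C \<subseteq> ground M" using X assms by blast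
    then have "kinser_inequality n M (\<lambda>i. X i \<union> C)"
      using assms(2) by (auto simp: kinser_class_def)
    then show ?thesis using kinser_inequality_shift[OF assms(1) shift X] by blast
  qed
  then show ?thesis using assms(3) by (auto simp: kinser_class_def)
qed

theorem lemma3p9:
  fixes n :: nat
  assumes "n \<ge> 4"
  shows "minor_closed (kinser_class n :: 'a set_system set)"
proof -
  have "N \<in> kinser_class n" if "minor N M" "M \<in> kinser_class n" for M N :: "'a set_system"
    using that
  proof (induction rule: minor.induct)
    case (minor_refl M)
    then show ?case .
  next
    case (minor_delete N M D)
    then have N: "N \<in> kinser_class n" "matroid N" by (auto simp: kinser_class_def)
    show ?case
    proof (rule kinser_class_shift[where C = "{}" and c = 0, OF assms N(1)])
      show "matroid (delete N D)" using N by (intro matroid.matroid_delete)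
      show "rank (delete N D) Y + 0 = rank N (Y \<union> {})" if "Y \<subseteq> ground (delete N D)" for Y
        using that rank_delete[of Y D N] by (auto simp: ground_delete)
    qed (auto simp: ground_delete)
  next
    case (minor_contract N M C)
    then have N: "N \<in> kinser_class n" "matroid N" by (auto simp: kinser_class_def)
    show ?case
    proof (rule kinser_class_shift[where C = C and c = "rank N C", OF assms N(1)])
      show "matroid (contract N C)" using N by (intro matroid.matroid_contract)
      show "rank (contract N C) Y + rank N C = rank N (Y \<union> C)"
        if "Y \<subseteq> ground (contract N C)" for Y
        using that N minor_contract by (intro matroid.rank_contract) (auto simp: ground_contract)
    qed (use minor_contract in \<open>auto simp: ground_contract\<close>)
  qed
  then show ?thesis by (auto simp: minor_closed_def)
qed

end
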